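(* Let $\Gamma$ be a group and $\mathbb{G}=[\partial:G_1\to G_0]$ a $\Gamma$-crossed-module. For $i=-1,0,1$, we have $$H^i(\Gamma,\mathbb{G})=H^i\,\mathcal{K}^{\leq1}(\Gamma,\mathbb{G}).$$
   Context: A crossed-module $\mathbb{G}=[\partial:G_1\to G_0]$ is a group homomorphism with a right action of $G_0$ on $G_1$ by automorphisms such that $\partial(\alpha^g)=g^{-1}\partial(\alpha)g$ and $\alpha^{\partial\beta}=\beta^{-1}\alpha\beta$. A $\Gamma$-crossed-module is one with left actions of $\Gamma$ on $G_0,G_1$ by automorphisms (written ${}^{\sigma}g$, ${}^{\sigma}\alpha$), with $\partial$ $\Gamma$-equivariant and ${}^{\sigma}(\alpha^g)=({}^{\sigma}\alpha)^{({}^{\sigma}g)}$. Pointed maps preserve identity elements. Cohomology. $H^{-1}(\Gamma,\mathbb{G})=(\ker\partial)^\Gamma$. $C^0(\Gamma,\mathbb{G})$ is the set of pairs $(g,\theta)$, $g\in G_0$, $\theta:\Gamma\to G_1$ a pointed map, with the group structure $(g_1,\theta_1)(g_2,\theta_2)=(g_1g_2,\ \sigma\mapsto\theta_1(\sigma)^{g_2}\theta_2(\sigma))$. $Z^0(\Gamma,\mathbb{G})$ is the subgroup of those $(g,\theta)$ with $\partial\theta(\sigma)=g^{-1}\,{}^{\sigma}g$ and $\theta(\sigma\tau)=\theta(\sigma)\,{}^{\sigma}\theta(\tau)$. $B^0(\Gamma,\mathbb{G})$ is the normal subgroup of pairs $(\partial\mu,\theta_\mu)$, $\mu\in G_1$,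 where $\theta_\mu(\sigma)=\mu^{-1}\,{}^{\sigma}\mu$, and $H^0(\Gamma,\mathbb{G})=Z^0/B^0$. $Z^1(\Gamma,\mathbb{G})$ is the set of pairs $(p,\varepsilon)$ of pointed maps $p:\Gamma\to G_0$, $\varepsilon:\Gamma\times\Gamma\to G_1$ with $p(\sigma\tau)\,\partial\varepsilon(\sigma,\tau)=p(\sigma)\,{}^{\sigma}p(\tau)$ and $\varepsilon(\sigma,\tau\upsilon)\,{}^{\sigma}\varepsilon(\tau,\upsilon)=\varepsilon(\sigma\tau,\upsilon)\,\varepsilon(\sigma,\tau)^{{}^{\sigma\tau}p(\upsilon)}$; its base point is the pair of constant maps $(1,1)$. The group $C^0(\Gamma,\mathbb{G})$ acts on the right on $Z^1(\Gamma,\mathbb{G})$ by $(p_1,\varepsilon_1)^{(g,\theta)}=(p_2,\varepsilon_2)$ with $$p_2(\sigma)=g^{-1}\,p_1(\sigma)\,{}^{\sigma}g\,\partial\theta(\sigma)^{-1},\qquad \varepsilon_2(\sigma,\tau)=\theta(\sigma\tau)\,\varepsilon_1(\sigma,\tau)^{{}^{\sigma\tau}g}\,{}^{\sigma}\theta(\tau)^{-1}\,\big(\theta(\sigma)^{-1}\big)^{{}^{\sigma}p_2(\tau)}.$$ The groupoid of 1-cocycles $\mathcal{Z}(\Gamma,\mathbb{G})=[Z^1(\Gamma,\mathbb{G})\times C^0(\Gamma,\mathbb{G})\rightrightarrows Z^1(\Gamma,\mathbb{G})]$ is the transformation groupoid of this action, so that an arrow $c\to c'$ is an element $(g,\theta)\in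 C^0(\Gamma,\mathbb{G})$ with $c^{(g,\theta)}=c'$. $H^1(\Gamma,\mathbb{G})$ is the pointed set of isomorphism classes of this groupoid. A crossed-module in groupoids is a morphism of groupoids $\partial:\mathcal{M}\to\mathcal{N}$ with $\mathcal{M}=\coprod_{x\in\mathrm{Ob}(\mathcal{N})}\mathcal{M}(x)$ a disjoint union of groups indexed by the objects of $\mathcal{N}$, with a right action of $\mathcal{N}$ on $\mathcal{M}$ (an arrow $x\to y$ acts $\mathcal{M}(x)\to\mathcal{M}(y)$) such that $\partial$ is equivariant for the right conjugation action of $\mathcal{N}$ on itself and $\alpha^{\partial\beta}=\beta^{-1}\alpha\beta$. Placed in degrees $[-1,1]$, its cohomologies are: $H^1$, the set of connected components of $\mathcal{N}$; and, for a fixed base point $x\in\mathrm{Ob}(\mathcal{N})$, $H^0$ and $H^{-1}$, the cokernel and the kernel of $\partial_x:\mathcal{M}(x)\to\mathcal{N}(x)$, where $\mathcal{N}(x)$ is the automorphism group of $x$. $\mathcal{K}^{\leq1}(\Gamma,\mathbb{G})=[\coprod_{c\in Z^1(\Gamma,\mathbb{G})}G_1(c)\xrightarrow{d}\mathcal{Z}(\Gamma,\mathbb{G})]$ with $G_1(c)=G_1$. For every $c\in Z^1(\Gamma,\mathbb{G})$, $d$ sends $\mu\in G_1(c)$ to $(\partial\mu,\theta_\mu)$, regarded as an arrow from $c$ to itself. An arrow $(g,\theta):c\to c'$ acts by $G_1(c)\to G_1(c')$, $\mu\mapsto\mu^g$. The base point used for $H^0$ and $H^{-1}$ is the base point $(1,1)$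 of $Z^1(\Gamma,\mathbb{G})$. *)

theory Defs
  imports "HOL-Algebra.Coset"
begin

section \<open>\<open>\<Gamma>\<close>-crossed-modules\<close>

text \<open>
  \<open>ract X \<alpha> g\<close> is the right action \<open>\<alpha>\<close> to the \<open>g\<close>; \<open>lact0 X \<sigma> g\<close> and \<open>lact1 X \<sigma> \<alpha>\<close> are the left
  actions of \<open>\<Gamma>\<close> on \<open>G0 X\<close> and \<open>G1 X\<close>.
\<close>

record ('s, 'a, 'b) gxmod =
  G0 :: "'a monoid"
  G1 :: "'b monoid"
  bd :: "'b \<Rightarrow> 'a"
  ract :: "'b \<Rightarrow> 'a \<Rightarrow> 'b"
  lact0 :: "'s \<Rightarrow> 'a \<Rightarrow> 'a"
  lact1 :: "'s \<Rightarrow> 'b \<Rightarrow> 'b"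

definition left_action_by_automorphisms ::
    "'s monoid \<Rightarrow> 'a monoid \<Rightarrow> ('s \<Rightarrow> 'a \<Rightarrow> 'a) \<Rightarrow> bool" where
  "left_action_by_automorphisms \<Gamma> G act \<longleftrightarrow>
     (\<forall>\<sigma>\<in>carrier \<Gamma>. act \<sigma> \<in> iso G G) \<and>
     (\<forall>x\<in>carrier G. act \<one>\<^bsub>\<Gamma>\<^esub> x = x) \<and>
     (\<forall>\<sigma>\<in>carrier \<Gamma>. \<forall>\<tau>\<in>carrier \<Gamma>. \<forall>x\<in>carrier G. act (\<sigma> \<otimes>\<^bsub>\<Gamma>\<^esub> \<tau>) x = act \<sigma> (act \<tau> x))"

definition right_action_by_automorphisms ::
    "'a monoid \<Rightarrow> 'b monoid \<Rightarrow> ('b \<Rightarrow> 'a \<Rightarrow> 'b) \<Rightarrow> bool" where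
  "right_action_by_automorphisms G M act \<longleftrightarrow>
     (\<forall>g\<in>carrier G. (\<lambda>\<alpha>. act \<alpha> g) \<in> iso M M) \<and>
     (\<forall>\<alpha>\<in>carrier M. act \<alpha> \<one>\<^bsub>G\<^esub> = \<alpha>) \<and>
     (\<forall>g\<in>carrier G. \<forall>h\<in>carrier G. \<forall>\<alpha>\<in>carrier M. act \<alpha> (g \<otimes>\<^bsub>G\<^esub> h) = act (act \<alpha> g) h)"

definition crossed_module :: "('s, 'a, 'b) gxmod \<Rightarrow> bool" where
  "crossed_module X \<longleftrightarrow>
     group_hom (G1 X) (G0 X) (bd X) \<and>
     right_action_by_automorphisms (G0 X) (G1 X) (ract X) \<and>
     (\<forall>\<alpha>\<in>carrier (G1 X). \<forall>g\<in>carrier (G0 X).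
        bd X (ract X \<alpha> g) = inv\<^bsub>G0 X\<^esub> g \<otimes>\<^bsub>G0 X\<^esub> bd X \<alpha> \<otimes>\<^bsub>G0 X\<^esub> g) \<and>
     (\<forall>\<alpha>\<in>carrier (G1 X). \<forall>\<beta>\<in>carrier (G1 X).
        ract X \<alpha> (bd X \<beta>) = inv\<^bsub>G1 X\<^esub> \<beta> \<otimes>\<^bsub>G1 X\<^esub> \<alpha> \<otimes>\<^bsub>G1 X\<^esub> \<beta>)"

definition gamma_crossed_module :: "'s monoid \<Rightarrow> ('s, 'a, 'b) gxmod \<Rightarrow> bool" where
  "gamma_crossed_module \<Gamma> X \<longleftrightarrow>
     crossed_module X \<and>
     left_action_by_automorphisms \<Gamma> (G0 X) (lact0 X) \<and>
     left_action_by_automorphisms \<Gamma> (G1 X) (lact1 X) \<and>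
     (\<forall>\<sigma>\<in>carrier \<Gamma>. \<forall>\<alpha>\<in>carrier (G1 X). bd X (lact1 X \<sigma> \<alpha>) = lact0 X \<sigma> (bd X \<alpha>)) \<and>
     (\<forall>\<sigma>\<in>carrier \<Gamma>. \<forall>\<alpha>\<in>carrier (G1 X). \<forall>g\<in>carrier (G0 X).
        lact1 X \<sigma> (ract X \<alpha> g) = ract X (lact1 X \<sigma> \<alpha>) (lact0 X \<sigma> g))"


section \<open>Cohomology of \<open>\<Gamma>\<close> with coefficients in a \<open>\<Gamma>\<close>-crossed-module\<close>

text \<open>
  Maps out of \<open>\<Gamma>\<close> and \<open>\<Gamma> \<times> \<Gamma>\<close> are extensional functions, so that equality of cochains is HOL
  equality.
\<close>

definition H_neg1 :: "'s monoid \<Rightarrow> ('s, 'a, 'b) gxmod \<Rightarrow> 'b monoid" where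
  "H_neg1 \<Gamma> X =
     (G1 X)\<lparr>carrier := {\<alpha> \<in> kernel (G1 X) (G0 X) (bd X). \<forall>\<sigma>\<in>carrier \<Gamma>. lact1 X \<sigma> \<alpha> = \<alpha>}\<rparr>"

definition C0 :: "'s monoid \<Rightarrow> ('s, 'a, 'b) gxmod \<Rightarrow> ('a \<times> ('s \<Rightarrow> 'b)) monoid" where
  "C0 \<Gamma> X =
     \<lparr>carrier = carrier (G0 X) \<times> {\<theta> \<in> carrier \<Gamma> \<rightarrow>\<^sub>E carrier (G1 X). \<theta> \<one>\<^bsub>\<Gamma>\<^esub> = \<one>\<^bsub>G1 X\<^esub>},
      mult = (\<lambda>(g\<^sub>1, \<theta>\<^sub>1) (g\<^sub>2, \<theta>\<^sub>2).
        (g\<^sub>1 \<otimes>\<^bsub>G0 X\<^esub> g\<^sub>2, \<lambda>\<sigma>\<in>carrier \<Gamma>. ract X (\<theta>\<^sub>1 \<sigma>) g\<^sub>2 \<otimes>\<^bsub>G1 X\<^esub> \<theta>\<^sub>2 \<sigma>)),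
      one = (\<one>\<^bsub>G0 X\<^esub>, \<lambda>\<sigma>\<in>carrier \<Gamma>. \<one>\<^bsub>G1 X\<^esub>)\<rparr>"

definition Z0 :: "'s monoid \<Rightarrow> ('s, 'a, 'b) gxmod \<Rightarrow> ('a \<times> ('s \<Rightarrow> 'b)) set" where
  "Z0 \<Gamma> X =
     {(g, \<theta>) \<in> carrier (C0 \<Gamma> X).
        (\<forall>\<sigma>\<in>carrier \<Gamma>. bd X (\<theta> \<sigma>) = inv\<^bsub>G0 X\<^esub> g \<otimes>\<^bsub>G0 X\<^esub> lact0 X \<sigma> g) \<and>
        (\<forall>\<sigma>\<in>carrier \<Gamma>. \<forall>\<tau>\<in>carrier \<Gamma>.
           \<theta> (\<sigma> \<otimes>\<^bsub>\<Gamma>\<^esub> \<tau>) = \<theta> \<sigma> \<otimes>\<^bsub>G1 X\<^esub> lact1 X \<sigma> (\<theta> \<tau>))}"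

definition theta :: "'s monoid \<Rightarrow> ('s, 'a, 'b) gxmod \<Rightarrow> 'b \<Rightarrow> 's \<Rightarrow> 'b" where
  "theta \<Gamma> X \<mu> = (\<lambda>\<sigma>\<in>carrier \<Gamma>. inv\<^bsub>G1 X\<^esub> \<mu> \<otimes>\<^bsub>G1 X\<^esub> lact1 X \<sigma> \<mu>)"

definition B0 :: "'s monoid \<Rightarrow> ('s, 'a, 'b) gxmod \<Rightarrow> ('a \<times> ('s \<Rightarrow> 'b)) set" where
  "B0 \<Gamma> X = {(bd X \<mu>, theta \<Gamma> X \<mu>) | \<mu>. \<mu> \<in> carrier (G1 X)}"

definition H_0 :: "'s monoid \<Rightarrow> ('s, 'a, 'b) gxmod \<Rightarrow> ('a \<times> ('s \<Rightarrow> 'b)) set monoid" where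
  "H_0 \<Gamma> X = (C0 \<Gamma> X)\<lparr>carrier := Z0 \<Gamma> X\<rparr> Mod B0 \<Gamma> X"

type_synonym ('s, 'a, 'b) cocycle1 = "('s \<Rightarrow> 'a) \<times> ('s \<times> 's \<Rightarrow> 'b)"

definition Z1 :: "'s monoid \<Rightarrow> ('s, 'a, 'b) gxmod \<Rightarrow> ('s, 'a, 'b) cocycle1 set" where
  "Z1 \<Gamma> X =
     {(p, \<epsilon>).
        p \<in> carrier \<Gamma> \<rightarrow>\<^sub>E carrier (G0 X) \<and> p \<one>\<^bsub>\<Gamma>\<^esub> = \<one>\<^bsub>G0 X\<^esub> \<and>
        \<epsilon> \<in> carrier \<Gamma> \<times> carrier \<Gamma> \<rightarrow>\<^sub>E carrier (G1 X) \<and> \<epsilon> (\<one>\<^bsub>\<Gamma>\<^esub>, \<one>\<^bsub>\<Gamma>\<^esub>) = \<one>\<^bsub>G1 X\<^esub> \<and>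
        (\<forall>\<sigma>\<in>carrier \<Gamma>. \<forall>\<tau>\<in>carrier \<Gamma>.
           p (\<sigma> \<otimes>\<^bsub>\<Gamma>\<^esub> \<tau>) \<otimes>\<^bsub>G0 X\<^esub> bd X (\<epsilon> (\<sigma>, \<tau>)) = p \<sigma> \<otimes>\<^bsub>G0 X\<^esub> lact0 X \<sigma> (p \<tau>)) \<and>
        (\<forall>\<sigma>\<in>carrier \<Gamma>. \<forall>\<tau>\<in>carrier \<Gamma>. \<forall>\<upsilon>\<in>carrier \<Gamma>.
           \<epsilon> (\<sigma>, \<tau> \<otimes>\<^bsub>\<Gamma>\<^esub> \<upsilon>) \<otimes>\<^bsub>G1 X\<^esub> lact1 X \<sigma> (\<epsilon> (\<tau>, \<upsilon>)) =
           \<epsilon> (\<sigma> \<otimes>\<^bsub>\<Gamma>\<^esub> \<tau>, \<upsilon>) \<otimes>\<^bsub>G1 X\<^esub> ract X (\<epsilon> (\<sigma>, \<tau>)) (lact0 X (\<sigma> \<otimes>\<^bsub>\<Gamma>\<^esub> \<tau>) (p \<upsilon>)))}"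

definition base1 :: "'s monoid \<Rightarrow> ('s, 'a, 'b) gxmod \<Rightarrow> ('s, 'a, 'b) cocycle1" where
  "base1 \<Gamma> X = (\<lambda>\<sigma>\<in>carrier \<Gamma>. \<one>\<^bsub>G0 X\<^esub>, \<lambda>x\<in>carrier \<Gamma> \<times> carrier \<Gamma>. \<one>\<^bsub>G1 X\<^esub>)"

definition act1 :: "'s monoid \<Rightarrow> ('s, 'a, 'b) gxmod \<Rightarrow>
    ('s, 'a, 'b) cocycle1 \<Rightarrow> 'a \<times> ('s \<Rightarrow> 'b) \<Rightarrow> ('s, 'a, 'b) cocycle1" where
  "act1 \<Gamma> X = (\<lambda>(p\<^sub>1, \<epsilon>\<^sub>1) (g, \<theta>).
     let p\<^sub>2 = (\<lambda>\<sigma>\<in>carrier \<Gamma>.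
           inv\<^bsub>G0 X\<^esub> g \<otimes>\<^bsub>G0 X\<^esub> p\<^sub>1 \<sigma> \<otimes>\<^bsub>G0 X\<^esub> lact0 X \<sigma> g \<otimes>\<^bsub>G0 X\<^esub> inv\<^bsub>G0 X\<^esub> (bd X (\<theta> \<sigma>)));
         \<epsilon>\<^sub>2 = (\<lambda>(\<sigma>, \<tau>)\<in>carrier \<Gamma> \<times> carrier \<Gamma>.
           \<theta> (\<sigma> \<otimes>\<^bsub>\<Gamma>\<^esub> \<tau>)
           \<otimes>\<^bsub>G1 X\<^esub> ract X (\<epsilon>\<^sub>1 (\<sigma>, \<tau>)) (lact0 X (\<sigma> \<otimes>\<^bsub>\<Gamma>\<^esub> \<tau>) g)
           \<otimes>\<^bsub>G1 X\<^esub> inv\<^bsub>G1 X\<^esub> (lact1 X \<sigma> (\<theta> \<tau>))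
           \<otimes>\<^bsub>G1 X\<^esub> ract X (inv\<^bsub>G1 X\<^esub> (\<theta> \<sigma>)) (lact0 X \<sigma> (p\<^sub>2 \<tau>)))
     in (p\<^sub>2, \<epsilon>\<^sub>2))"


section \<open>Groupoids\<close>

text \<open>
  Groupoids enter through their data: \<open>Arr N x y\<close> is the set of arrows from \<open>x\<close> to \<open>y\<close>, and
  \<open>Comp N x y z f h\<close> is \<open>f\<close> from \<open>x\<close> to \<open>y\<close> followed by \<open>h\<close> from \<open>y\<close> to \<open>z\<close>.
\<close>

record ('o, 'n) groupoid =
  Ob :: "'o set"
  Arr :: "'o \<Rightarrow> 'o \<Rightarrow> 'n set"
  Comp :: "'o \<Rightarrow> 'o \<Rightarrow> 'o \<Rightarrow> 'n \<Rightarrow> 'n \<Rightarrow> 'n"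
  Ident :: "'o \<Rightarrow> 'n"

definition automorphism_group :: "('o, 'n) groupoid \<Rightarrow> 'o \<Rightarrow> 'n monoid" where
  "automorphism_group N x = \<lparr>carrier = Arr N x x, mult = Comp N x x x, one = Ident N x\<rparr>"

text \<open>All arrows of a groupoid are invertible, so objects joined by an arrow are isomorphic.\<close>

definition isomorphic_objects :: "('o, 'n) groupoid \<Rightarrow> 'o rel" where
  "isomorphic_objects N = {(x, y). x \<in> Ob N \<and> y \<in> Ob N \<and> Arr N x y \<noteq> {}}"

text \<open>Connectedness: joined by a finite zigzag of arrows.\<close>

definition connected_objects :: "('o, 'n) groupoid \<Rightarrow> 'o rel" where
  "connected_objects N =
     {(x, y). x \<in> Ob N \<and> y \<in> Ob N \<and>
        (x, y) \<in> ({(u, v). u \<in> Ob N \<and> v \<in> Ob N \<and> (Arr N u v \<noteq> {} \<or> Arr N v u \<noteq> {})})\<^sup>*}"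

definition transformation_groupoid ::
    "'o set \<Rightarrow> 'n monoid \<Rightarrow> ('o \<Rightarrow> 'n \<Rightarrow> 'o) \<Rightarrow> ('o, 'n) groupoid" where
  "transformation_groupoid S G act =
     \<lparr>Ob = S,
      Arr = (\<lambda>x y. {g \<in> carrier G. act x g = y}),
      Comp = (\<lambda>x y z g h. g \<otimes>\<^bsub>G\<^esub> h),
      Ident = (\<lambda>x. \<one>\<^bsub>G\<^esub>)\<rparr>"

definition cocycle_groupoid :: "'s monoid \<Rightarrow> ('s, 'a, 'b) gxmod \<Rightarrow>
    (('s, 'a, 'b) cocycle1, 'a \<times> ('s \<Rightarrow> 'b)) groupoid" where
  "cocycle_groupoid \<Gamma> X = transformation_groupoid (Z1 \<Gamma> X) (C0 \<Gamma> X) (act1 \<Gamma> X)"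

text \<open>A pointed set is a pair of a set and its base point.\<close>

definition H_1 :: "'s monoid \<Rightarrow> ('s, 'a, 'b) gxmod \<Rightarrow>
    ('s, 'a, 'b) cocycle1 set set \<times> ('s, 'a, 'b) cocycle1 set" where
  "H_1 \<Gamma> X =
     (Z1 \<Gamma> X // isomorphic_objects (cocycle_groupoid \<Gamma> X),
      isomorphic_objects (cocycle_groupoid \<Gamma> X) `` {base1 \<Gamma> X})"


section \<open>Crossed-modules in groupoids\<close>

text \<open>
  \<open>MGrp K x\<close> is the group over the object \<open>x\<close>, \<open>Bd K x\<close> its map to the arrows from \<open>x\<close> to \<open>x\<close>, and
  \<open>MAct K x y \<alpha> f\<close> the right action on it of an arrow \<open>f\<close> from \<open>x\<close> to \<open>y\<close>.
\<close>

record ('o, 'n, 'm) groupoid_xmod =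
  NGpd :: "('o, 'n) groupoid"
  MGrp :: "'o \<Rightarrow> 'm monoid"
  Bd :: "'o \<Rightarrow> 'm \<Rightarrow> 'n"
  MAct :: "'o \<Rightarrow> 'o \<Rightarrow> 'm \<Rightarrow> 'n \<Rightarrow> 'm"

definition xH_neg1 :: "('o, 'n, 'm) groupoid_xmod \<Rightarrow> 'o \<Rightarrow> 'm monoid" where
  "xH_neg1 K x =
     (MGrp K x)\<lparr>carrier := kernel (MGrp K x) (automorphism_group (NGpd K) x) (Bd K x)\<rparr>"

definition xH_0 :: "('o, 'n, 'm) groupoid_xmod \<Rightarrow> 'o \<Rightarrow> 'n set monoid" where
  "xH_0 K x = automorphism_group (NGpd K) x Mod (Bd K x ` carrier (MGrp K x))"

definition xH_1 :: "('o, 'n, 'm) groupoid_xmod \<Rightarrow> 'o \<Rightarrow> 'o set set \<times> 'o set" where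
  "xH_1 K x =
     (Ob (NGpd K) // connected_objects (NGpd K), connected_objects (NGpd K) `` {x})"

text \<open>
  The boundary below uses the same formula at every object \<open>c\<close>, and composition of arrows is the
  multiplication of \<open>C0\<close>. At the base point these are, respectively, a homomorphism to the
  automorphism group and the group law of \<open>Z0\<close>. At a general \<open>c = (p, \<epsilon>)\<close> the formula need not give
  an arrow that fixes \<open>c\<close>, and \<open>act1\<close> need not be compatible with the multiplication of \<open>C0\<close>.
  Neither affects the cohomologies: the groups are taken at the base point, and the components
  depend only on which objects are joined by an arrow.
\<close>

definition K_le1 :: "'s monoid \<Rightarrow> ('s, 'a, 'b) gxmod \<Rightarrow>
    (('s, 'a, 'b) cocycle1, 'a \<times> ('s \<Rightarrow> 'b), 'b) groupoid_xmod" where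
  "K_le1 \<Gamma> X =
     \<lparr>NGpd = cocycle_groupoid \<Gamma> X,
      MGrp = (\<lambda>c. G1 X),
      Bd = (\<lambda>c \<mu>. (bd X \<mu>, theta \<Gamma> X \<mu>)),
      MAct = (\<lambda>c c' \<mu> (g, \<theta>). ract X \<mu> g)\<rparr>"

end

theory Submission
  imports Defs
begin

text \<open>
  Degrees \<open>-1\<close> and \<open>0\<close> are a direct comparison at the base point. The boundary of \<open>\<mu>\<close> is trivial
  exactly if \<open>\<mu>\<close> lies in the kernel of \<open>\<partial>\<close> and \<open>\<theta>\<^sub>\<mu>(\<sigma>) = \<mu>\<inverse> \<sigma>\<mu>\<close> vanishes, that is, \<open>\<mu>\<close> is
  \<open>\<Gamma>\<close>-invariant. The two equations that say that \<open>(g, \<theta>)\<close> stabilizes the base point are the two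
  equations that define \<open>Z0\<close> (lemma \<open>Z0_eq_stabilizer\<close>).

  In degree 1, isomorphism classes are compared with connected components, so what has to be shown
  is that being joined by a single arrow is already an equivalence relation. The multiplication of
  \<open>C0\<close> does not provide this, because at a general 1-cocycle the formula for the action need not be
  compatible with it: combining \<open>p\<^sub>2(\<sigma>) = g\<inverse> p\<^sub>1(\<sigma>) \<sigma>g \<partial>\<theta>(\<sigma>)\<inverse>\<close> with
  \<open>p\<^sub>3(\<sigma>) = h\<inverse> p\<^sub>2(\<sigma>) \<sigma>h \<partial>\<phi>(\<sigma>)\<inverse>\<close> moves \<open>\<partial>\<theta>(\<sigma>)\<inverse>\<close> past \<open>\<sigma>h\<close>, not past \<open>h\<close>. Writing \<open>\<alpha>[g]\<close> for
  the right action of \<open>g\<close> on \<open>\<alpha>\<close>, the formula is compatible with the twisted product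
  \<open>(g, \<theta>) (h, \<phi>) = (g h, \<sigma> \<mapsto> \<phi>(\<sigma>) \<theta>(\<sigma>)[\<sigma>h])\<close>
  on the same set of pairs (lemma \<open>act1_twisted_mult\<close>). On the stabilizer of the base point both
  products agree by the Peiffer identity, since there \<open>h \<partial>\<phi>(\<sigma>) = \<sigma>h\<close>. Every pair has a right inverse
  for the twisted product, and the unit acts trivially, so reflexivity, symmetry and transitivity
  follow.
\<close>

text \<open>
  An equivalence relation is its own closure under zigzags. Since \<open>groupoid\<close> is a record of bare
  data, \<open>isomorphic_objects\<close> can fail to be an equivalence relation, so this is assumed.
\<close>

lemma connected_objects_eq_isomorphic_objects:
  assumes "equiv (Ob N) (isomorphic_objects N)"
  shows "connected_objects N = isomorphic_objects N"
proof -
  let ?r = "isomorphic_objects N"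
  have "{(u, v). u \<in> Ob N \<and> v \<in> Ob N \<and> (Arr N u v \<noteq> {} \<or> Arr N v u \<noteq> {})} = ?r \<union> ?r\<inverse>"
    by (auto simp: isomorphic_objects_def)
  also have "\<dots> = ?r"
    using assms by (auto simp: equiv_def dest: symD)
  finally have "connected_objects N = {(x, y). x \<in> Ob N \<and> y \<in> Ob N \<and> (x, y) \<in> ?r\<^sup>*}"
    by (simp add: connected_objects_def)
  moreover have "?r\<^sup>* = ?r\<^sup>="
    using assms trancl_id[of ?r] by (metis equiv_def reflcl_trancl)
  moreover have "?r \<subseteq> Ob N \<times> Ob N"
    by (auto simp: isomorphic_objects_def)
  ultimately show ?thesis
    using assms by (auto simp: equiv_def refl_on_def)
qed


section \<open>Calculating in a \<open>\<Gamma>\<close>-crossed-module\<close>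

locale \<Gamma>_xmod = \<Gamma>: group \<Gamma> + G0: group "G0 X" + G1: group "G1 X"
  for \<Gamma> :: "'s monoid" and X :: "('s, 'a, 'b) gxmod" +
  assumes gamma_crossed_module: "gamma_crossed_module \<Gamma> X"
begin

abbreviation mult0 (infixl "\<cdot>\<^sub>0" 70) where "mult0 \<equiv> mult (G0 X)"
abbreviation mult1 (infixl "\<cdot>\<^sub>1" 70) where "mult1 \<equiv> mult (G1 X)"
abbreviation inv0 where "inv0 \<equiv> m_inv (G0 X)"
abbreviation inv1 where "inv1 \<equiv> m_inv (G1 X)"

lemmas xmod_defs = gamma_crossed_module_def crossed_module_def
  left_action_by_automorphisms_def right_action_by_automorphisms_def

lemma bd_hom: "group_hom (G1 X) (G0 X) (bd X)"
  using gamma_crossed_module by (simp add: xmod_defs)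

lemma ract_hom: "g \<in> carrier (G0 X) \<Longrightarrow> group_hom (G1 X) (G1 X) (\<lambda>\<alpha>. ract X \<alpha> g)"
  using gamma_crossed_module
  by (simp add: xmod_defs iso_def group_hom_def group_hom_axioms_def G1.is_group)

lemma lact0_hom: "\<sigma> \<in> carrier \<Gamma> \<Longrightarrow> group_hom (G0 X) (G0 X) (lact0 X \<sigma>)"
  using gamma_crossed_module
  by (simp add: xmod_defs iso_def group_hom_def group_hom_axioms_def G0.is_group)

lemma lact1_hom: "\<sigma> \<in> carrier \<Gamma> \<Longrightarrow> group_hom (G1 X) (G1 X) (lact1 X \<sigma>)"
  using gamma_crossed_module
  by (simp add: xmod_defs iso_def group_hom_def group_hom_axioms_def G1.is_group)

lemmas bd_simps [simp] =
  group_hom.hom_closed[OF bd_hom] group_hom.hom_mult[OF bd_hom]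
  group_hom.hom_one[OF bd_hom] group_hom.hom_inv[OF bd_hom]
lemmas ract_simps [simp] =
  group_hom.hom_closed[OF ract_hom] group_hom.hom_mult[OF ract_hom]
  group_hom.hom_one[OF ract_hom] group_hom.hom_inv[OF ract_hom]
lemmas lact0_simps [simp] =
  group_hom.hom_closed[OF lact0_hom] group_hom.hom_mult[OF lact0_hom]
  group_hom.hom_one[OF lact0_hom] group_hom.hom_inv[OF lact0_hom]
lemmas lact1_simps [simp] =
  group_hom.hom_closed[OF lact1_hom] group_hom.hom_mult[OF lact1_hom]
  group_hom.hom_one[OF lact1_hom] group_hom.hom_inv[OF lact1_hom]

lemma ract_one [simp]: "\<alpha> \<in> carrier (G1 X) \<Longrightarrow> ract X \<alpha> \<one>\<^bsub>G0 X\<^esub> = \<alpha>"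
  using gamma_crossed_module by (simp add: xmod_defs)

lemma ract_ract:
  "\<lbrakk>\<alpha> \<in> carrier (G1 X); g \<in> carrier (G0 X); h \<in> carrier (G0 X)\<rbrakk>
    \<Longrightarrow> ract X (ract X \<alpha> g) h = ract X \<alpha> (g \<cdot>\<^sub>0 h)"
  using gamma_crossed_module by (simp add: xmod_defs)

lemma lact0_lact0 [simp]:
  "\<lbrakk>\<sigma> \<in> carrier \<Gamma>; \<tau> \<in> carrier \<Gamma>; g \<in> carrier (G0 X)\<rbrakk>
    \<Longrightarrow> lact0 X \<sigma> (lact0 X \<tau> g) = lact0 X (\<sigma> \<otimes>\<^bsub>\<Gamma>\<^esub> \<tau>) g"
  using gamma_crossed_module by (simp add: xmod_defs)

lemma lact0_bd:
  "\<lbrakk>\<sigma> \<in> carrier \<Gamma>; \<alpha> \<in> carrier (G1 X)\<rbrakk> \<Longrightarrow> lact0 X \<sigma> (bd X \<alpha>) = bd X (lact1 X \<sigma> \<alpha>)"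
  using gamma_crossed_module by (simp add: xmod_defs)

lemma lact1_ract:
  "\<lbrakk>\<sigma> \<in> carrier \<Gamma>; \<alpha> \<in> carrier (G1 X); g \<in> carrier (G0 X)\<rbrakk>
    \<Longrightarrow> lact1 X \<sigma> (ract X \<alpha> g) = ract X (lact1 X \<sigma> \<alpha>) (lact0 X \<sigma> g)"
  using gamma_crossed_module by (simp add: xmod_defs)

lemma bd_ract:
  "\<lbrakk>\<alpha> \<in> carrier (G1 X); g \<in> carrier (G0 X)\<rbrakk>
    \<Longrightarrow> bd X (ract X \<alpha> g) = inv0 g \<cdot>\<^sub>0 bd X \<alpha> \<cdot>\<^sub>0 g"
  using gamma_crossed_module by (simp add: xmod_defs)

lemma peiffer:
  "\<lbrakk>\<alpha> \<in> carrier (G1 X); \<beta> \<in> carrier (G1 X)\<rbrakk>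
    \<Longrightarrow> ract X \<alpha> (bd X \<beta>) = inv1 \<beta> \<cdot>\<^sub>1 \<alpha> \<cdot>\<^sub>1 \<beta>"
  using gamma_crossed_module by (simp add: xmod_defs)

lemma G0_cancel [simp]:
  "\<lbrakk>g \<in> carrier (G0 X); h \<in> carrier (G0 X)\<rbrakk> \<Longrightarrow> g \<cdot>\<^sub>0 (inv0 g \<cdot>\<^sub>0 h) = h"
  "\<lbrakk>g \<in> carrier (G0 X); h \<in> carrier (G0 X)\<rbrakk> \<Longrightarrow> inv0 g \<cdot>\<^sub>0 (g \<cdot>\<^sub>0 h) = h"
  by (simp_all flip: G0.m_assoc)

lemma G1_cancel [simp]:
  "\<lbrakk>\<alpha> \<in> carrier (G1 X); \<beta> \<in> carrier (G1 X)\<rbrakk> \<Longrightarrow> \<alpha> \<cdot>\<^sub>1 (inv1 \<alpha> \<cdot>\<^sub>1 \<beta>) = \<beta>"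
  "\<lbrakk>\<alpha> \<in> carrier (G1 X); \<beta> \<in> carrier (G1 X)\<rbrakk> \<Longrightarrow> inv1 \<alpha> \<cdot>\<^sub>1 (\<alpha> \<cdot>\<^sub>1 \<beta>) = \<beta>"
  by (simp_all flip: G1.m_assoc)


section \<open>The twisted product of 0-cochains\<close>

abbreviation cochains1 :: "('s, 'a, 'b) cocycle1 set" where
  "cochains1 \<equiv>
    (carrier \<Gamma> \<rightarrow>\<^sub>E carrier (G0 X)) \<times> (carrier \<Gamma> \<times> carrier \<Gamma> \<rightarrow>\<^sub>E carrier (G1 X))"

text \<open>
  The second component has its factors in the opposite order from \<open>mult (C0 \<Gamma> X)\<close>, and \<open>h\<close> is
  replaced by \<open>\<sigma>h\<close>; the definition of \<open>act1\<close> forces both changes, as it multiplies by \<open>\<partial>\<theta>(\<sigma>)\<inverse>\<close> to the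
  right of \<open>\<sigma>g\<close>.
\<close>

definition twisted_mult ::
    "'a \<times> ('s \<Rightarrow> 'b) \<Rightarrow> 'a \<times> ('s \<Rightarrow> 'b) \<Rightarrow> 'a \<times> ('s \<Rightarrow> 'b)" where
  "twisted_mult = (\<lambda>(g, \<theta>) (h, \<phi>).
     (g \<cdot>\<^sub>0 h, \<lambda>\<sigma>\<in>carrier \<Gamma>. \<phi> \<sigma> \<cdot>\<^sub>1 ract X (\<theta> \<sigma>) (lact0 X \<sigma> h)))"

definition twisted_inv :: "'a \<times> ('s \<Rightarrow> 'b) \<Rightarrow> 'a \<times> ('s \<Rightarrow> 'b)" where
  "twisted_inv = (\<lambda>(g, \<theta>).
     (inv0 g, \<lambda>\<sigma>\<in>carrier \<Gamma>. ract X (inv1 (\<theta> \<sigma>)) (lact0 X \<sigma> (inv0 g))))"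

lemma one_closed: "\<one>\<^bsub>C0 \<Gamma> X\<^esub> \<in> carrier (C0 \<Gamma> X)"
  by (auto simp: C0_def)

lemma twisted_mult_closed:
  "\<lbrakk>a \<in> carrier (C0 \<Gamma> X); b \<in> carrier (C0 \<Gamma> X)\<rbrakk> \<Longrightarrow> twisted_mult a b \<in> carrier (C0 \<Gamma> X)"
  by (auto simp: C0_def twisted_mult_def PiE_iff)

lemma twisted_inv_closed:
  "a \<in> carrier (C0 \<Gamma> X) \<Longrightarrow> twisted_inv a \<in> carrier (C0 \<Gamma> X)"
  by (auto simp: C0_def twisted_inv_def PiE_iff)

text \<open>
  Only a right inverse is provided: acting with \<open>a\<close> and then with \<open>twisted_inv a\<close> returns to the
  start, which is what reverses an arrow.
\<close>

lemma twisted_inv_right: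
  assumes "a \<in> carrier (C0 \<Gamma> X)"
  shows "twisted_mult a (twisted_inv a) = \<one>\<^bsub>C0 \<Gamma> X\<^esub>"
proof -
  have "ract X (inv1 \<alpha>) g \<cdot>\<^sub>1 ract X \<alpha> g = \<one>\<^bsub>G1 X\<^esub>"
    if "\<alpha> \<in> carrier (G1 X)" "g \<in> carrier (G0 X)" for \<alpha> g
    using that by (simp flip: group_hom.hom_mult[OF ract_hom])
  then show ?thesis
    using assms
    by (auto simp: C0_def twisted_mult_def twisted_inv_def PiE_iff simp del: ract_simps(4)
      intro!: restrict_ext)
qed

lemma act1_one:
  assumes "c \<in> cochains1"
  shows "act1 \<Gamma> X c \<one>\<^bsub>C0 \<Gamma> X\<^esub> = c"
proof -
  obtain p \<epsilon> where c: "c = (p, \<epsilon>)" and p: "p \<in> carrier \<Gamma> \<rightarrow>\<^sub>E carrier (G0 X)"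
    and \<epsilon>: "\<epsilon> \<in> carrier \<Gamma> \<times> carrier \<Gamma> \<rightarrow>\<^sub>E carrier (G1 X)"
    using assms by auto
  have \<epsilon>': "\<epsilon> (\<sigma>, \<tau>) \<in> carrier (G1 X)" if "\<sigma> \<in> carrier \<Gamma>" "\<tau> \<in> carrier \<Gamma>" for \<sigma> \<tau>
    using \<epsilon> that by (auto simp: PiE_mem)
  have "fst (act1 \<Gamma> X c \<one>\<^bsub>C0 \<Gamma> X\<^esub>) = p"
    by (rule extensionalityI[where A = "carrier \<Gamma>"])
      (use p in \<open>auto simp: c act1_def C0_def Let_def PiE_iff\<close>)
  moreover have "snd (act1 \<Gamma> X c \<one>\<^bsub>C0 \<Gamma> X\<^esub>) = \<epsilon>"
    by (rule extensionalityI[where A = "carrier \<Gamma> \<times> carrier \<Gamma>"])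
      (use p \<epsilon> \<epsilon>' in \<open>auto simp: c act1_def C0_def Let_def PiE_iff\<close>)
  ultimately show ?thesis
    by (simp add: c prod_eq_iff)
qed

text \<open>
  For the maps \<open>p\<close> this is \<open>\<partial>(\<alpha>[g]) = g\<inverse> \<partial>\<alpha> g\<close>. For the maps \<open>\<epsilon>\<close>, expand both sides as products in
  \<open>G1 X\<close>: the same factors occur, with \<open>\<theta>(\<sigma>)\<inverse>\<close> transported by \<open>\<sigma>p\<^sub>2(\<tau>) \<sigma>\<tau>h\<close> to the left of
  \<open>\<sigma>\<phi>(\<tau>)\<inverse>\<close> on one side, and by \<open>\<sigma>h \<sigma>p\<^sub>3(\<tau>)\<close> to the right of it on the other. These two elements of
  \<open>G0 X\<close> differ by \<open>\<sigma>\<partial>\<phi>(\<tau>)\<inverse>\<close>, so that the Peiffer identity exchanges the factors.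
\<close>

lemma act1_twisted_mult:
  assumes "c \<in> cochains1" "a \<in> carrier (C0 \<Gamma> X)" "b \<in> carrier (C0 \<Gamma> X)"
  shows "act1 \<Gamma> X (act1 \<Gamma> X c a) b = act1 \<Gamma> X c (twisted_mult a b)"
proof -
  obtain p \<epsilon> where c: "c = (p, \<epsilon>)" by (cases c)
  obtain g \<theta> where a: "a = (g, \<theta>)" by (cases a)
  obtain h \<phi> where b: "b = (h, \<phi>)" by (cases b)
  have [simp]: "g \<in> carrier (G0 X)" "h \<in> carrier (G0 X)"
    "\<And>\<sigma>. \<sigma> \<in> carrier \<Gamma> \<Longrightarrow> p \<sigma> \<in> carrier (G0 X)"
    "\<And>\<sigma>. \<sigma> \<in> carrier \<Gamma> \<Longrightarrow> \<theta> \<sigma> \<in> carrier (G1 X)"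
    "\<And>\<sigma>. \<sigma> \<in> carrier \<Gamma> \<Longrightarrow> \<phi> \<sigma> \<in> carrier (G1 X)"
    "\<And>\<sigma> \<tau>. \<lbrakk>\<sigma> \<in> carrier \<Gamma>; \<tau> \<in> carrier \<Gamma>\<rbrakk> \<Longrightarrow> \<epsilon> (\<sigma>, \<tau>) \<in> carrier (G1 X)"
    using assms by (auto simp: a b c C0_def PiE_mem)
  define p\<^sub>2 where "p\<^sub>2 = fst (act1 \<Gamma> X c a)"
  define p\<^sub>3 where "p\<^sub>3 = fst (act1 \<Gamma> X (act1 \<Gamma> X c a) b)"
  have p\<^sub>2: "p\<^sub>2 \<sigma> = inv0 g \<cdot>\<^sub>0 p \<sigma> \<cdot>\<^sub>0 lact0 X \<sigma> g \<cdot>\<^sub>0 inv0 (bd X (\<theta> \<sigma>))"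
    if "\<sigma> \<in> carrier \<Gamma>" for \<sigma>
    using that by (simp add: p\<^sub>2_def a c act1_def Let_def)
  have p\<^sub>2_closed [simp]: "p\<^sub>2 \<sigma> \<in> carrier (G0 X)" if "\<sigma> \<in> carrier \<Gamma>" for \<sigma>
    using that by (simp add: p\<^sub>2)
  have p\<^sub>3: "p\<^sub>3 \<sigma> = inv0 h \<cdot>\<^sub>0 p\<^sub>2 \<sigma> \<cdot>\<^sub>0 lact0 X \<sigma> h \<cdot>\<^sub>0 inv0 (bd X (\<phi> \<sigma>))"
    if "\<sigma> \<in> carrier \<Gamma>" for \<sigma>
    using that by (simp add: p\<^sub>3_def p\<^sub>2_def a b c act1_def Let_def)
  have p\<^sub>3_closed [simp]: "p\<^sub>3 \<sigma> \<in> carrier (G0 X)" if "\<sigma> \<in> carrier \<Gamma>" for \<sigma>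
    using that by (simp add: p\<^sub>3)
  have fst_eq: "p\<^sub>3 = fst (act1 \<Gamma> X c (twisted_mult a b))"
  proof (rule extensionalityI[where A = "carrier \<Gamma>"])
    fix \<sigma> assume [simp]: "\<sigma> \<in> carrier \<Gamma>"
    show "p\<^sub>3 \<sigma> = fst (act1 \<Gamma> X c (twisted_mult a b)) \<sigma>"
      by (simp add: p\<^sub>2 p\<^sub>3 a b c act1_def Let_def twisted_mult_def bd_ract
        G0.m_assoc G0.inv_mult_group)
  qed (auto simp: p\<^sub>3_def act1_def a b c Let_def twisted_mult_def)
  have snd_eq: "snd (act1 \<Gamma> X (act1 \<Gamma> X c a) b) = snd (act1 \<Gamma> X c (twisted_mult a b))"
  proof (rule extensionalityI[where A = "carrier \<Gamma> \<times> carrier \<Gamma>"])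
    fix x assume "x \<in> carrier \<Gamma> \<times> carrier \<Gamma>"
    then obtain \<sigma> \<tau> where x: "x = (\<sigma>, \<tau>)" and [simp]: "\<sigma> \<in> carrier \<Gamma>" "\<tau> \<in> carrier \<Gamma>"
      by auto
    define \<kappa> where "\<kappa> = lact1 X \<sigma> (\<phi> \<tau>)"
    define \<rho> where "\<rho> = ract X (inv1 (\<theta> \<sigma>)) (lact0 X \<sigma> (p\<^sub>2 \<tau>) \<cdot>\<^sub>0 lact0 X (\<sigma> \<otimes>\<^bsub>\<Gamma>\<^esub> \<tau>) h)"
    have [simp]: "\<kappa> \<in> carrier (G1 X)" "\<rho> \<in> carrier (G1 X)"
      by (simp_all add: \<kappa>_def \<rho>_def del: ract_simps(4))
    have "lact0 X \<sigma> h \<cdot>\<^sub>0 lact0 X \<sigma> (p\<^sub>3 \<tau>)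
        = lact0 X \<sigma> (p\<^sub>2 \<tau>) \<cdot>\<^sub>0 lact0 X (\<sigma> \<otimes>\<^bsub>\<Gamma>\<^esub> \<tau>) h \<cdot>\<^sub>0 bd X (inv1 \<kappa>)"
      by (simp add: p\<^sub>3 \<kappa>_def lact0_bd G0.m_assoc)
    then have "ract X (inv1 (\<theta> \<sigma>)) (lact0 X \<sigma> h \<cdot>\<^sub>0 lact0 X \<sigma> (p\<^sub>3 \<tau>)) = ract X \<rho> (bd X (inv1 \<kappa>))"
      by (simp add: \<rho>_def ract_ract del: bd_simps(4) ract_simps(4))
    also have "\<dots> = \<kappa> \<cdot>\<^sub>1 \<rho> \<cdot>\<^sub>1 inv1 \<kappa>"
      by (simp add: peiffer del: bd_simps(4))
    finally have swap: "inv1 \<kappa> \<cdot>\<^sub>1 ract X (inv1 (\<theta> \<sigma>)) (lact0 X \<sigma> h \<cdot>\<^sub>0 lact0 X \<sigma> (p\<^sub>3 \<tau>)) = \<rho> \<cdot>\<^sub>1 inv1 \<kappa>"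
      by (simp add: G1.m_assoc)
    define u where "u = \<phi> (\<sigma> \<otimes>\<^bsub>\<Gamma>\<^esub> \<tau>) \<cdot>\<^sub>1 ract X (\<theta> (\<sigma> \<otimes>\<^bsub>\<Gamma>\<^esub> \<tau>)) (lact0 X (\<sigma> \<otimes>\<^bsub>\<Gamma>\<^esub> \<tau>) h)
      \<cdot>\<^sub>1 ract X (\<epsilon> (\<sigma>, \<tau>)) (lact0 X (\<sigma> \<otimes>\<^bsub>\<Gamma>\<^esub> \<tau>) (g \<cdot>\<^sub>0 h))
      \<cdot>\<^sub>1 ract X (inv1 (lact1 X \<sigma> (\<theta> \<tau>))) (lact0 X (\<sigma> \<otimes>\<^bsub>\<Gamma>\<^esub> \<tau>) h)"
    define v where "v = ract X (inv1 (\<phi> \<sigma>)) (lact0 X \<sigma> (p\<^sub>3 \<tau>))"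
    have [simp]: "u \<in> carrier (G1 X)" "v \<in> carrier (G1 X)"
      by (simp_all add: u_def v_def del: ract_simps(4))
    have "snd (act1 \<Gamma> X (act1 \<Gamma> X c a) b) x =
        \<phi> (\<sigma> \<otimes>\<^bsub>\<Gamma>\<^esub> \<tau>)
        \<cdot>\<^sub>1 ract X (snd (act1 \<Gamma> X c a) (\<sigma>, \<tau>)) (lact0 X (\<sigma> \<otimes>\<^bsub>\<Gamma>\<^esub> \<tau>) h) \<cdot>\<^sub>1 inv1 \<kappa> \<cdot>\<^sub>1 v"
      by (simp add: x a b c act1_def Let_def \<kappa>_def v_def p\<^sub>3_def)
    also have "snd (act1 \<Gamma> X c a) (\<sigma>, \<tau>) =
        \<theta> (\<sigma> \<otimes>\<^bsub>\<Gamma>\<^esub> \<tau>) \<cdot>\<^sub>1 ract X (\<epsilon> (\<sigma>, \<tau>)) (lact0 X (\<sigma> \<otimes>\<^bsub>\<Gamma>\<^esub> \<tau>) g)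
        \<cdot>\<^sub>1 inv1 (lact1 X \<sigma> (\<theta> \<tau>)) \<cdot>\<^sub>1 ract X (inv1 (\<theta> \<sigma>)) (lact0 X \<sigma> (p\<^sub>2 \<tau>))"
      by (simp add: a c act1_def Let_def p\<^sub>2_def)
    also have "\<phi> (\<sigma> \<otimes>\<^bsub>\<Gamma>\<^esub> \<tau>) \<cdot>\<^sub>1 ract X \<dots> (lact0 X (\<sigma> \<otimes>\<^bsub>\<Gamma>\<^esub> \<tau>) h) = u \<cdot>\<^sub>1 \<rho>"
      by (simp add: u_def \<rho>_def ract_ract G1.m_assoc del: ract_simps(4))
    also have "u \<cdot>\<^sub>1 \<rho> \<cdot>\<^sub>1 inv1 \<kappa> \<cdot>\<^sub>1 v = u \<cdot>\<^sub>1 (\<rho> \<cdot>\<^sub>1 inv1 \<kappa>) \<cdot>\<^sub>1 v"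
      by (simp add: G1.m_assoc)
    also have "\<dots> = u \<cdot>\<^sub>1
        (inv1 \<kappa> \<cdot>\<^sub>1 ract X (inv1 (\<theta> \<sigma>)) (lact0 X \<sigma> h \<cdot>\<^sub>0 lact0 X \<sigma> (p\<^sub>3 \<tau>))) \<cdot>\<^sub>1 v"
      by (simp only: swap)
    also have "\<dots> = snd (act1 \<Gamma> X c (twisted_mult a b)) x"
    proof -
      have "fst (act1 \<Gamma> X c (twisted_mult a b)) \<tau> = p\<^sub>3 \<tau>"
        by (simp add: fst_eq)
      then have p\<^sub>3': "inv0 (g \<cdot>\<^sub>0 h) \<cdot>\<^sub>0 p \<tau> \<cdot>\<^sub>0 lact0 X \<tau> (g \<cdot>\<^sub>0 h)
          \<cdot>\<^sub>0 inv0 (bd X (\<phi> \<tau> \<cdot>\<^sub>1 ract X (\<theta> \<tau>) (lact0 X \<tau> h))) = p\<^sub>3 \<tau>"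
        by (simp add: a b c act1_def Let_def twisted_mult_def del: lact0_simps bd_simps)
      have "snd (act1 \<Gamma> X c (twisted_mult a b)) x =
          \<phi> (\<sigma> \<otimes>\<^bsub>\<Gamma>\<^esub> \<tau>) \<cdot>\<^sub>1 ract X (\<theta> (\<sigma> \<otimes>\<^bsub>\<Gamma>\<^esub> \<tau>)) (lact0 X (\<sigma> \<otimes>\<^bsub>\<Gamma>\<^esub> \<tau>) h)
          \<cdot>\<^sub>1 ract X (\<epsilon> (\<sigma>, \<tau>)) (lact0 X (\<sigma> \<otimes>\<^bsub>\<Gamma>\<^esub> \<tau>) (g \<cdot>\<^sub>0 h))
          \<cdot>\<^sub>1 inv1 (lact1 X \<sigma> (\<phi> \<tau> \<cdot>\<^sub>1 ract X (\<theta> \<tau>) (lact0 X \<tau> h)))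
          \<cdot>\<^sub>1 ract X (inv1 (\<phi> \<sigma> \<cdot>\<^sub>1 ract X (\<theta> \<sigma>) (lact0 X \<sigma> h))) (lact0 X \<sigma> (p\<^sub>3 \<tau>))"
        by (simp add: x a b c act1_def Let_def twisted_mult_def p\<^sub>3'
          del: lact0_simps lact1_simps ract_simps bd_simps)
      then show ?thesis
        by (simp add: u_def v_def \<kappa>_def lact1_ract ract_ract G1.inv_mult_group G1.m_assoc)
    qed
    finally show "snd (act1 \<Gamma> X (act1 \<Gamma> X c a) b) x = snd (act1 \<Gamma> X c (twisted_mult a b)) x" .
  qed (auto simp: act1_def a b c Let_def twisted_mult_def)
  show ?thesis
    using fst_eq snd_eq by (simp add: p\<^sub>3_def prod_eq_iff)
qed


section \<open>The comparison in each degree\<close>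

lemma equiv_isomorphic_objects:
  "equiv (Z1 \<Gamma> X) (isomorphic_objects (cocycle_groupoid \<Gamma> X))"
proof -
  let ?R = "isomorphic_objects (cocycle_groupoid \<Gamma> X)"
  have R_iff: "(c, c') \<in> ?R \<longleftrightarrow>
      c \<in> Z1 \<Gamma> X \<and> c' \<in> Z1 \<Gamma> X \<and> (\<exists>a\<in>carrier (C0 \<Gamma> X). act1 \<Gamma> X c a = c')" for c c'
    by (auto simp: isomorphic_objects_def cocycle_groupoid_def transformation_groupoid_def)
  have cochain: "c \<in> cochains1" if "c \<in> Z1 \<Gamma> X" for c
    using that by (auto simp: Z1_def)
  show ?thesis
  proof (rule equivI)
    show "?R \<subseteq> Z1 \<Gamma> X \<times> Z1 \<Gamma> X"
      by (auto simp: R_iff)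
    show "refl_on (Z1 \<Gamma> X) ?R"
    proof (rule refl_onI)
      fix c assume "c \<in> Z1 \<Gamma> X"
      then show "(c, c) \<in> ?R"
        unfolding R_iff using one_closed act1_one[OF cochain] by blast
    qed
    show "sym ?R"
    proof (rule symI)
      fix c c' assume "(c, c') \<in> ?R"
      then obtain a where a: "a \<in> carrier (C0 \<Gamma> X)" "act1 \<Gamma> X c a = c'"
        and c: "c \<in> Z1 \<Gamma> X" "c' \<in> Z1 \<Gamma> X"
        unfolding R_iff by blast
      have "act1 \<Gamma> X c' (twisted_inv a) = c"
        using act1_twisted_mult[OF cochain[OF c(1)] a(1) twisted_inv_closed[OF a(1)]] a(2)
        by (simp add: twisted_inv_right[OF a(1)] act1_one[OF cochain[OF c(1)]])
      then show "(c', c) \<in> ?R"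
        using c twisted_inv_closed[OF a(1)] by (auto simp: R_iff)
    qed
    show "trans ?R"
    proof (rule transI)
      fix c c' c'' assume "(c, c') \<in> ?R" "(c', c'') \<in> ?R"
      then obtain a b where ab: "a \<in> carrier (C0 \<Gamma> X)" "b \<in> carrier (C0 \<Gamma> X)"
          "act1 \<Gamma> X c a = c'" "act1 \<Gamma> X c' b = c''"
        and c: "c \<in> Z1 \<Gamma> X" "c'' \<in> Z1 \<Gamma> X"
        unfolding R_iff by blast
      have "act1 \<Gamma> X c (twisted_mult a b) = c''"
        using act1_twisted_mult[OF cochain[OF c(1)] ab(1,2)] ab(3,4) by simp
      then show "(c, c'') \<in> ?R"
        using c twisted_mult_closed[OF ab(1,2)] by (auto simp: R_iff)
    qed
  qed
qed

text \<open>
  At the base point the new \<open>p\<^sub>2(\<sigma>)\<close> is \<open>g\<inverse> \<sigma>g \<partial>\<theta>(\<sigma>)\<inverse>\<close>, and once \<open>p\<^sub>2\<close> is trivial the new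
  \<open>\<epsilon>\<^sub>2(\<sigma>, \<tau>)\<close> is \<open>\<theta>(\<sigma>\<tau>) (\<theta>(\<sigma>) \<sigma>\<theta>(\<tau>))\<inverse>\<close>.
\<close>

lemma Z0_eq_stabilizer:
  "Z0 \<Gamma> X = {a \<in> carrier (C0 \<Gamma> X). act1 \<Gamma> X (base1 \<Gamma> X) a = base1 \<Gamma> X}"
proof -
  have "a \<in> Z0 \<Gamma> X \<longleftrightarrow> act1 \<Gamma> X (base1 \<Gamma> X) a = base1 \<Gamma> X" if "a \<in> carrier (C0 \<Gamma> X)" for a
  proof -
    obtain g \<theta> where a: "a = (g, \<theta>)" by (cases a)
    have [simp]: "g \<in> carrier (G0 X)" "\<And>\<sigma>. \<sigma> \<in> carrier \<Gamma> \<Longrightarrow> \<theta> \<sigma> \<in> carrier (G1 X)"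
      using that by (auto simp: a C0_def PiE_mem)
    define p\<^sub>2 where "p\<^sub>2 = fst (act1 \<Gamma> X (base1 \<Gamma> X) a)"
    define \<epsilon>\<^sub>2 where "\<epsilon>\<^sub>2 = snd (act1 \<Gamma> X (base1 \<Gamma> X) a)"
    have p\<^sub>2: "p\<^sub>2 \<sigma> = inv0 g \<cdot>\<^sub>0 lact0 X \<sigma> g \<cdot>\<^sub>0 inv0 (bd X (\<theta> \<sigma>))" if "\<sigma> \<in> carrier \<Gamma>" for \<sigma>
      using that by (simp add: p\<^sub>2_def a base1_def act1_def Let_def)
    have [simp]: "p\<^sub>2 \<sigma> \<in> carrier (G0 X)" if "\<sigma> \<in> carrier \<Gamma>" for \<sigma>
      using that by (simp add: p\<^sub>2)
    have \<epsilon>\<^sub>2: "\<epsilon>\<^sub>2 (\<sigma>, \<tau>) = \<theta> (\<sigma> \<otimes>\<^bsub>\<Gamma>\<^esub> \<tau>) \<cdot>\<^sub>1 inv1 (lact1 X \<sigma> (\<theta> \<tau>))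
        \<cdot>\<^sub>1 ract X (inv1 (\<theta> \<sigma>)) (lact0 X \<sigma> (p\<^sub>2 \<tau>))" if "\<sigma> \<in> carrier \<Gamma>" "\<tau> \<in> carrier \<Gamma>" for \<sigma> \<tau>
      using that by (simp add: \<epsilon>\<^sub>2_def p\<^sub>2_def a base1_def act1_def Let_def)
    have p\<^sub>2_iff: "p\<^sub>2 \<sigma> = \<one>\<^bsub>G0 X\<^esub> \<longleftrightarrow> bd X (\<theta> \<sigma>) = inv0 g \<cdot>\<^sub>0 lact0 X \<sigma> g"
      if "\<sigma> \<in> carrier \<Gamma>" for \<sigma>
      using that by (auto simp: p\<^sub>2 G0.inv_solve_right' G0.r_inv)
    have \<epsilon>\<^sub>2_iff: "\<epsilon>\<^sub>2 (\<sigma>, \<tau>) = \<one>\<^bsub>G1 X\<^esub> \<longleftrightarrow> \<theta> (\<sigma> \<otimes>\<^bsub>\<Gamma>\<^esub> \<tau>) = \<theta> \<sigma> \<cdot>\<^sub>1 lact1 X \<sigma> (\<theta> \<tau>)"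
      if "\<sigma> \<in> carrier \<Gamma>" "\<tau> \<in> carrier \<Gamma>" "p\<^sub>2 \<tau> = \<one>\<^bsub>G0 X\<^esub>" for \<sigma> \<tau>
    proof -
      have "\<epsilon>\<^sub>2 (\<sigma>, \<tau>) = \<theta> (\<sigma> \<otimes>\<^bsub>\<Gamma>\<^esub> \<tau>) \<cdot>\<^sub>1 inv1 (\<theta> \<sigma> \<cdot>\<^sub>1 lact1 X \<sigma> (\<theta> \<tau>))"
        using that by (simp add: \<epsilon>\<^sub>2 G1.inv_mult_group G1.m_assoc)
      then show ?thesis
        using that by (auto simp: G1.inv_solve_right')
    qed
    have "act1 \<Gamma> X (base1 \<Gamma> X) a = base1 \<Gamma> X \<longleftrightarrow> p\<^sub>2 = fst (base1 \<Gamma> X) \<and> \<epsilon>\<^sub>2 = snd (base1 \<Gamma> X)"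
      by (simp add: p\<^sub>2_def \<epsilon>\<^sub>2_def prod_eq_iff)
    also have "p\<^sub>2 = fst (base1 \<Gamma> X) \<longleftrightarrow> (\<forall>\<sigma>\<in>carrier \<Gamma>. p\<^sub>2 \<sigma> = \<one>\<^bsub>G0 X\<^esub>)"
      by (auto simp: p\<^sub>2_def a base1_def act1_def Let_def restrict_def fun_eq_iff)
    also have "\<epsilon>\<^sub>2 = snd (base1 \<Gamma> X) \<longleftrightarrow>
        (\<forall>\<sigma>\<in>carrier \<Gamma>. \<forall>\<tau>\<in>carrier \<Gamma>. \<epsilon>\<^sub>2 (\<sigma>, \<tau>) = \<one>\<^bsub>G1 X\<^esub>)"
      by (auto simp: \<epsilon>\<^sub>2_def a base1_def act1_def Let_def restrict_def fun_eq_iff)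
    finally show ?thesis
      using that p\<^sub>2_iff \<epsilon>\<^sub>2_iff by (auto simp: Z0_def a)
  qed
  moreover have "Z0 \<Gamma> X \<subseteq> carrier (C0 \<Gamma> X)"
    by (auto simp: Z0_def)
  ultimately show ?thesis
    by blast
qed

lemma H_neg1_eq: "H_neg1 \<Gamma> X = xH_neg1 (K_le1 \<Gamma> X) (base1 \<Gamma> X)"
proof -
  have "theta \<Gamma> X \<mu> = (\<lambda>\<sigma>\<in>carrier \<Gamma>. \<one>\<^bsub>G1 X\<^esub>) \<longleftrightarrow> (\<forall>\<sigma>\<in>carrier \<Gamma>. lact1 X \<sigma> \<mu> = \<mu>)"
    if "\<mu> \<in> carrier (G1 X)" for \<mu>
  proof -
    have "inv1 \<mu> \<cdot>\<^sub>1 \<nu> = \<one>\<^bsub>G1 X\<^esub> \<longleftrightarrow> \<nu> = \<mu>" if "\<nu> \<in> carrier (G1 X)" for \<nu>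
      using that \<open>\<mu> \<in> carrier (G1 X)\<close> by (auto simp: G1.inv_solve_left')
    then show ?thesis
      using that by (auto simp: theta_def restrict_def fun_eq_iff)
  qed
  then show ?thesis
    by (auto simp: H_neg1_def xH_neg1_def K_le1_def cocycle_groupoid_def
      transformation_groupoid_def automorphism_group_def kernel_def C0_def
      intro!: arg_cong[where f = "\<lambda>S. (G1 X)\<lparr>carrier := S\<rparr>"])
qed

lemma H_0_eq: "H_0 \<Gamma> X = xH_0 (K_le1 \<Gamma> X) (base1 \<Gamma> X)"
proof -
  have "automorphism_group (cocycle_groupoid \<Gamma> X) (base1 \<Gamma> X) = (C0 \<Gamma> X)\<lparr>carrier := Z0 \<Gamma> X\<rparr>"
    by (simp add: automorphism_group_def cocycle_groupoid_def transformation_groupoid_def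
      Z0_eq_stabilizer)
  moreover have "(\<lambda>\<mu>. (bd X \<mu>, theta \<Gamma> X \<mu>)) ` carrier (G1 X) = B0 \<Gamma> X"
    by (auto simp: B0_def)
  ultimately show ?thesis
    by (simp add: H_0_def xH_0_def K_le1_def)
qed

lemma H_1_eq: "H_1 \<Gamma> X = xH_1 (K_le1 \<Gamma> X) (base1 \<Gamma> X)"
proof -
  have Ob: "Ob (cocycle_groupoid \<Gamma> X) = Z1 \<Gamma> X"
    by (simp add: cocycle_groupoid_def transformation_groupoid_def)
  show ?thesis
    using connected_objects_eq_isomorphic_objects[of "cocycle_groupoid \<Gamma> X"]
      equiv_isomorphic_objects
    by (simp add: H_1_def xH_1_def K_le1_def Ob)
qed

end


theorem proposition5p1:
  fixes \<Gamma> :: "'s monoid" and X :: "('s, 'a, 'b) gxmod"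
  assumes "group \<Gamma>" and "gamma_crossed_module \<Gamma> X"
  shows "H_neg1 \<Gamma> X = xH_neg1 (K_le1 \<Gamma> X) (base1 \<Gamma> X) \<and>
         H_0 \<Gamma> X = xH_0 (K_le1 \<Gamma> X) (base1 \<Gamma> X) \<and>
         H_1 \<Gamma> X = xH_1 (K_le1 \<Gamma> X) (base1 \<Gamma> X)"
proof -
  have "group_hom (G1 X) (G0 X) (bd X)"
    using assms(2) by (simp add: gamma_crossed_module_def crossed_module_def)
  then interpret \<Gamma>_xmod \<Gamma> X
    using assms by (simp add: \<Gamma>_xmod_def \<Gamma>_xmod_axioms_def group_hom_def)
  show ?thesis
    using H_neg1_eq H_0_eq H_1_eq by simp
qed

end
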